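(* Let $g(x,z)=\exp((x^2+1)\ln z)=z^{x^2+1}$ for $z>0$. Let $W\subset\mathbb{R}^3$ be the graph $\{(x,y,z): y=g(x,z)\}$ of $g$ for $z>0$ and $x$, $z$ small, let $X$ be the $x$-axis (near the origin), and let $S_g=W\cup X$, stratified by the two strata $W$ and $X$. Then conditions $(n)$ and $(npf)$ (for $S_g$ along $X$) fail at $(0,0,0)$.
   Context: Let $\pi$ be the orthogonal projection onto the $x$-axis and $\mu(v)=v/|v|$. The normal cone $C_XS$ of $S=S_g$ along $X$ is the part lying over $X$ of the closure in $\mathbb{R}^3\times S^2$ of $\{(y,\mu(\pi(y)-y)):y\in S\setminus X\}$; $p:C_XS\to X$ is the projection and $(C_XS)_x$ its fibre at $x$. Condition $(n)$ at $x\in X$: $(C_XS)_x$ equals the tangent cone $C_x(S_x)$ at $x$ of the fibre $S_x=S\cap\pi^{-1}(x)$, i.e. the set of all limits of $\mu(x-y)$ as $y\to x$, $y\in S_x\setminus\{x\}$ (same sign convention). Condition $(npf)$ (normal pseudo-flatness): $p:C_XS\to X$ is an open map; it fails at $(0,0,0)$ if $p$ is not open when $X$ is replaced by an arbitrarily small neighbourhood of $(0,0,0)$ in $X$. *)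

theory Defs
  imports "HOL-Analysis.Analysis"
begin

definition proj_x :: "real^3 \<Rightarrow> real^3" where
  "proj_x v = vector [v $ 1, 0, 0]"

definition \<mu> :: "real^3 \<Rightarrow> real^3" where
  "\<mu> v = v /\<^sub>R norm v"

definition normal_cone :: "(real^3) set \<Rightarrow> (real^3) set \<Rightarrow> ((real^3) \<times> (real^3)) set" where
  "normal_cone S X =
     (top_of_set (UNIV \<times> sphere 0 1) closure_of {(y, \<mu> (proj_x y - y)) | y. y \<in> S - X})
       \<inter> (X \<times> UNIV)"

definition normal_cone_fibre :: "(real^3) set \<Rightarrow> (real^3) set \<Rightarrow> real^3 \<Rightarrow> (real^3) set" where
  "normal_cone_fibre S X x = {v. (x, v) \<in> normal_cone S X}"

definition tangent_cone :: "(real^3) set \<Rightarrow> real^3 \<Rightarrow> (real^3) set" where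
  "tangent_cone A x =
     {v. \<exists>y. (\<forall>k::nat. y k \<in> A - {x}) \<and> y \<longlonglongrightarrow> x \<and> (\<lambda>k. \<mu> (x - y k)) \<longlonglongrightarrow> v}"

definition condition_n :: "(real^3) set \<Rightarrow> (real^3) set \<Rightarrow> real^3 \<Rightarrow> bool" where
  "condition_n S X x \<longleftrightarrow> normal_cone_fibre S X x = tangent_cone (S \<inter> proj_x -` {x}) x"

text \<open>Normal pseudo-flatness over a part \<open>X'\<close> of \<open>X\<close>: the projection of the part of the normal
  cone lying over \<open>X'\<close> is an open map to \<open>X'\<close>. The case \<open>X' = X\<close> is normal pseudo-flatness
  itself.\<close>

definition npf_over :: "(real^3) set \<Rightarrow> (real^3) set \<Rightarrow> (real^3) set \<Rightarrow> bool" where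
  "npf_over S X X' \<longleftrightarrow>
     open_map (top_of_set (normal_cone S X \<inter> (X' \<times> UNIV))) (top_of_set X') fst"

definition npf_fails_at :: "(real^3) set \<Rightarrow> (real^3) set \<Rightarrow> real^3 \<Rightarrow> bool" where
  "npf_fails_at S X x \<longleftrightarrow>
     (\<forall>X'. openin (top_of_set X) X' \<and> x \<in> X' \<longrightarrow> \<not> npf_over S X X')"

definition g :: "real \<Rightarrow> real \<Rightarrow> real" where
  "g x z = exp ((x\<^sup>2 + 1) * ln z)"

text \<open>A set \<open>U\<close> in the \<open>(x,z)\<close>-plane, an arbitrary open neighbourhood of the origin, says how
  small \<open>x\<close> and \<open>z\<close> are.\<close>

definition stratum_W :: "(real \<times> real) set \<Rightarrow> (real^3) set" where
  "stratum_W U = {vector [x, g x z, z] | x z. (x, z) \<in> U \<and> z > 0}"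

definition stratum_X :: "(real \<times> real) set \<Rightarrow> (real^3) set" where
  "stratum_X U = {vector [x, 0, 0] | x. (x, 0) \<in> U}"

definition S_g :: "(real \<times> real) set \<Rightarrow> (real^3) set" where
  "S_g U = stratum_W U \<union> stratum_X U"

end

theory Submission
  imports Defs "HOL-Real_Asymp.Real_Asymp"
begin

text \<open>The secant direction at \<open>(x, g(x,z), z)\<close> is that of \<open>(0, -r, -1)\<close> with
  \<open>r = z powr x\<^sup>2\<close>. As \<open>(x, z)\<close> tends to \<open>(a, 0)\<close>, \<open>r\<close> tends to 0 if \<open>a\<close> is nonzero. For \<open>a = 0\<close>
  the limit depends on the path: it is 1 along \<open>x = 0\<close>, but 0 along \<open>x = 1/n\<close>,
  \<open>z = exp(-n\<^sup>3)\<close>. So over the origin the normal cone contains the directions of \<open>(0, 0, -1)\<close>,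
  which is not tangent to the fibre, and of \<open>(0, -1, -1)\<close>, which is isolated from the fibres over
  the other points.\<close>

lemma tendsto_vector_3:
  fixes a b c :: "'i \<Rightarrow> 'a::{topological_space, zero}"
  assumes "(a \<longlongrightarrow> a') F" "(b \<longlongrightarrow> b') F" "(c \<longlongrightarrow> c') F"
  shows "((\<lambda>n. vector [a n, b n, c n] :: 'a^3) \<longlongrightarrow> vector [a', b', c']) F"
proof (rule vec_tendstoI)
  fix i :: 3
  show "((\<lambda>n. (vector [a n, b n, c n] :: 'a^3) $ i) \<longlongrightarrow> (vector [a', b', c'] :: 'a^3) $ i) F"
    using assms exhaust_3[of i] by auto
qed

lemma norm_\<mu>: "v \<noteq> 0 \<Longrightarrow> norm (\<mu> v) = 1"
  by (simp add: \<mu>_def)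

lemma \<mu>_scaleR: "c > 0 \<Longrightarrow> \<mu> (c *\<^sub>R v) = \<mu> v"
  by (simp add: \<mu>_def)

lemma tendsto_\<mu>: "(f \<longlongrightarrow> v) F \<Longrightarrow> v \<noteq> 0 \<Longrightarrow> ((\<lambda>x. \<mu> (f x)) \<longlongrightarrow> \<mu> v) F"
  unfolding \<mu>_def by (intro tendsto_intros) auto

lemma direction_nz: "vector [0, - r, - 1] \<noteq> (0 :: real^3)"
  by (auto simp: vec_eq_iff forall_3)

text \<open>Factoring out \<open>z\<close> isolates the quotient r =
  \<open>exp (x\<^sup>2 * ln z)\<close>, the slope of the secant in the normal plane.\<close>

lemma g_eq: "z > 0 \<Longrightarrow> g x z = z * exp (x\<^sup>2 * ln z)"
  by (simp add: g_def algebra_simps exp_add)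

lemma secant_direction:
  assumes "z > 0"
  shows "\<mu> (proj_x (vector [x, g x z, z]) - vector [x, g x z, z])
           = \<mu> (vector [0, - exp (x\<^sup>2 * ln z), - 1])"
proof -
  have "proj_x (vector [x, g x z, z]) - vector [x, g x z, z]
          = z *\<^sub>R vector [0, - exp (x\<^sup>2 * ln z), - 1]"
    using assms by (simp add: vec_eq_iff forall_3 proj_x_def g_eq)
  then show ?thesis
    using \<mu>_scaleR[OF assms] by simp
qed

lemma S_g_minus_stratum_X: "S_g U - stratum_X U = stratum_W U"
  by (auto simp: S_g_def stratum_W_def stratum_X_def vec_eq_iff forall_3)

text \<open>This is the set whose closure yields the normal cone, parametrized by
  \<open>(x, z)\<close> and with each direction in the form that depends on r alone.\<close>

definition secants :: "(real \<times> real) set \<Rightarrow> ((real^3) \<times> (real^3)) set" where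
  "secants U = {(vector [x, g x z, z], \<mu> (vector [0, - exp (x\<^sup>2 * ln z), - 1])) | x z.
                  (x, z) \<in> U \<and> z > 0}"

text \<open>The product of the whole space with the unit sphere is closed and contains all secants,
  so the relative closure is the ordinary one.\<close>

lemma normal_cone_S_g:
  "normal_cone (S_g U) (stratum_X U) = closure (secants U) \<inter> (stratum_X U \<times> UNIV)"
proof -
  have eq: "{(y, \<mu> (proj_x y - y)) | y. y \<in> stratum_W U} = secants U"
    unfolding stratum_W_def secants_def using secant_direction by fastforce
  have sub: "secants U \<subseteq> UNIV \<times> sphere 0 1"
    by (auto simp: secants_def norm_\<mu> direction_nz)
  have "closure (secants U) \<subseteq> UNIV \<times> sphere 0 1"
    using sub by (intro closure_minimal closed_Times) auto
  then show ?thesis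
    unfolding normal_cone_def S_g_minus_stratum_X eq closure_of_subtopology
    using sub by (auto simp: Int_absorb1)
qed

text \<open>Convergence of r suffices: then g = z r tends to 0 with z, so the base points approach
  the axis. Only eventual membership in \<open>U\<close> is asked, so that explicit sequences need
  no shift.\<close>

lemma normal_coneI:
  fixes x z :: "nat \<Rightarrow> real"
  assumes "\<forall>\<^sub>F n in sequentially. (x n, z n) \<in> U" "\<And>n. z n > 0" "(a, 0) \<in> U"
    and "x \<longlonglongrightarrow> a" "z \<longlonglongrightarrow> 0" and r: "(\<lambda>n. exp ((x n)\<^sup>2 * ln (z n))) \<longlonglongrightarrow> r"
  shows "(vector [a, 0, 0], \<mu> (vector [0, - r, - 1])) \<in> normal_cone (S_g U) (stratum_X U)"
proof -
  have "(\<lambda>n. z n * exp ((x n)\<^sup>2 * ln (z n))) \<longlonglongrightarrow> 0"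
    using tendsto_mult[OF \<open>z \<longlonglongrightarrow> 0\<close> r] by simp
  then have "(\<lambda>n. g (x n) (z n)) \<longlonglongrightarrow> 0"
    using assms(2) by (simp add: g_eq)
  then have "(\<lambda>n. (vector [x n, g (x n) (z n), z n] :: real^3,
               \<mu> (vector [0, - exp ((x n)\<^sup>2 * ln (z n)), - 1])))
      \<longlonglongrightarrow> (vector [a, 0, 0], \<mu> (vector [0, - r, - 1]))"
    using assms by (intro tendsto_Pair tendsto_\<mu> tendsto_vector_3 tendsto_intros direction_nz)
  moreover have "\<forall>\<^sub>F n in sequentially. (vector [x n, g (x n) (z n), z n] :: real^3,
               \<mu> (vector [0, - exp ((x n)\<^sup>2 * ln (z n)), - 1])) \<in> closure (secants U)"
    using assms(1) by eventually_elim
      (rule subsetD[OF closure_subset], use assms(2) in \<open>auto simp: secants_def\<close>)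
  ultimately have "(vector [a, 0, 0], \<mu> (vector [0, - r, - 1])) \<in> closure (secants U)"
    by (intro Lim_in_closed_set[OF closed_closure _ trivial_limit_sequentially])
  then show ?thesis
    using \<open>(a, 0) \<in> U\<close> unfolding normal_cone_S_g by (auto simp: stratum_X_def)
qed

lemma normal_cone_direction:
  assumes "(p, v) \<in> normal_cone (S_g U) (stratum_X U)" "p $ 1 \<noteq> 0"
  shows "v $ 2 = 0"
proof -
  have "(p, v) \<in> closure (secants U)" and p: "p $ 3 = 0"
    using assms(1) unfolding normal_cone_S_g by (auto simp: stratum_X_def)
  then obtain w where w: "\<And>n. w n \<in> secants U" "w \<longlonglongrightarrow> (p, v)"
    by (auto simp: closure_sequential)
  have "\<forall>n. \<exists>x z. w n = (vector [x, g x z, z], \<mu> (vector [0, - exp (x\<^sup>2 * ln z), - 1])) \<and> z > 0"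
    using w(1) unfolding secants_def by fastforce
  then obtain x z where
    xz: "\<And>n. w n = (vector [x n, g (x n) (z n), z n], \<mu> (vector [0, - exp ((x n)\<^sup>2 * ln (z n)), - 1]))"
    and z: "\<And>n. z n > 0"
    by metis
  have "(\<lambda>n. fst (w n) $ 1) \<longlonglongrightarrow> p $ 1" "(\<lambda>n. fst (w n) $ 3) \<longlonglongrightarrow> p $ 3"
    and v2: "(\<lambda>n. snd (w n) $ 2) \<longlonglongrightarrow> v $ 2"
    using tendsto_fst[OF w(2)] tendsto_snd[OF w(2)] by (auto intro: tendsto_vec_nth)
  then have x_lim: "x \<longlonglongrightarrow> p $ 1" and z_lim: "z \<longlonglongrightarrow> 0"
    using p by (simp_all add: xz)
  \<comment> \<open>Positivity of \<open>z n\<close> makes the convergence one-sided, as the limit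
    of \<open>ln\<close> at 0 requires.\<close>
  have "filterlim z (at_right 0) sequentially"
    using z_lim z by (simp add: filterlim_at less_imp_neq[OF z, symmetric])
  then have "filterlim (\<lambda>n. ln (z n)) at_bot sequentially"
    using ln_at_0 filterlim_compose by blast
  then have "filterlim (\<lambda>n. (x n)\<^sup>2 * ln (z n)) at_bot sequentially"
    using assms(2) by (intro filterlim_tendsto_pos_mult_at_bot[OF tendsto_power[OF x_lim]]) auto
  then have r_lim: "(\<lambda>n. exp ((x n)\<^sup>2 * ln (z n))) \<longlonglongrightarrow> 0"
    using exp_at_bot filterlim_compose by blast
  have "(\<lambda>n. snd (w n)) \<longlonglongrightarrow> \<mu> (vector [0, - 0, - 1])"
    unfolding xz snd_conv
    by (intro tendsto_\<mu> tendsto_vector_3 tendsto_minus r_lim tendsto_const direction_nz)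
  then have "(\<lambda>n. snd (w n) $ 2) \<longlonglongrightarrow> \<mu> (vector [0, - 0, - 1]) $ 2"
    by (rule tendsto_vec_nth)
  with v2 show ?thesis
    by (auto dest: LIMSEQ_unique simp: \<mu>_def)
qed

text \<open>For x = 0 the exponent is 1, so the fibre lies on the line y = z, and this linear
  equation survives scaling and limits.\<close>

lemma tangent_cone_direction:
  assumes "v \<in> tangent_cone (S_g U \<inter> proj_x -` {vector [0, 0, 0]}) (vector [0, 0, 0])"
  shows "v $ 2 = v $ 3"
proof -
  obtain y where y: "\<And>k. y k \<in> S_g U \<inter> proj_x -` {vector [0, 0, 0]} - {vector [0, 0, 0]}"
    and lim: "(\<lambda>k. \<mu> (vector [0, 0, 0] - y k)) \<longlonglongrightarrow> v"
    using assms by (auto simp: tangent_cone_def)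
  have "y k $ 2 = y k $ 3" for k
    using y[of k]
    by (auto simp: S_g_def stratum_W_def stratum_X_def proj_x_def g_def vec_eq_iff forall_3)
  then have "\<mu> (vector [0, 0, 0] - y k) $ 2 = \<mu> (vector [0, 0, 0] - y k) $ 3" for k
    by (simp add: \<mu>_def)
  then show ?thesis
    using tendsto_vec_nth[OF lim, of 2] tendsto_vec_nth[OF lim, of 3] LIMSEQ_unique by simp
qed

theorem mainTheorem9:
  fixes U :: "(real \<times> real) set"
  assumes "open U" and "(0, 0) \<in> U"
  shows "\<not> condition_n (S_g U) (stratum_X U) (vector [0, 0, 0]) \<and>
         npf_fails_at (S_g U) (stratum_X U) (vector [0, 0, 0])"
proof
  let ?N = "normal_cone (S_g U) (stratum_X U)"
  let ?O = "vector [0, 0, 0] :: real^3"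
  have in_U: "\<forall>\<^sub>F n in sequentially. (x n, z n) \<in> U" if "x \<longlonglongrightarrow> 0" "z \<longlonglongrightarrow> 0" for x z
    using topological_tendstoD[OF tendsto_Pair[OF that] assms] .

  have "(?O, \<mu> (vector [0, - 0, - 1])) \<in> ?N"
  proof (rule normal_coneI)
    let ?x = "\<lambda>n. 1 / real (Suc n)" and ?z = "\<lambda>n. exp (- (real (Suc n) ^ 3))"
    show x: "?x \<longlonglongrightarrow> 0" and z: "?z \<longlonglongrightarrow> 0"
      by real_asymp+
    show "\<forall>\<^sub>F n in sequentially. (?x n, ?z n) \<in> U"
      using in_U[OF x z] .
    show "(\<lambda>n. exp ((?x n)\<^sup>2 * ln (?z n))) \<longlonglongrightarrow> 0"
      by real_asymp
  qed (use assms in auto)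
  moreover have "\<mu> (vector [0, - 0, - 1]) \<notin> tangent_cone (S_g U \<inter> proj_x -` {?O}) ?O"
  proof
    assume "\<mu> (vector [0, - 0, - 1]) \<in> tangent_cone (S_g U \<inter> proj_x -` {?O}) ?O"
    \<comment> \<open>The second coordinate is 0 and the third is not; \<open>direction_nz\<close>
      excludes a zero norm, for which \<open>inverse 0 = 0\<close> would make both vanish.\<close>
    from tangent_cone_direction[OF this] direction_nz[of 0] show False
      by (simp add: \<mu>_def)
  qed
  ultimately show "\<not> condition_n (S_g U) (stratum_X U) ?O"
    by (auto simp: condition_n_def normal_cone_fibre_def)

  define d :: "real^3" where "d = \<mu> (vector [0, - 1, - 1])"
  have d2: "d $ 2 \<noteq> 0"
    using direction_nz[of 1] by (simp add: d_def \<mu>_def)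
  have d_in: "(?O, d) \<in> ?N"
    unfolding d_def
  proof (rule normal_coneI)
    \<comment> \<open>Along x = 0, r is constantly 1; \<open>Suc n\<close> keeps z positive for
      every n.\<close>
    show x: "(\<lambda>n. 0) \<longlonglongrightarrow> (0::real)" and z: "(\<lambda>n. 1 / real (Suc n)) \<longlonglongrightarrow> 0"
      by real_asymp+
    show "\<forall>\<^sub>F n in sequentially. (0, 1 / real (Suc n)) \<in> U"
      using in_U[OF x z] .
  qed (use assms in auto)
  show "npf_fails_at (S_g U) (stratum_X U) ?O"
    unfolding npf_fails_at_def
  proof (intro allI impI notI)
    fix X' assume X': "openin (top_of_set (stratum_X U)) X' \<and> ?O \<in> X'"
      and npf: "npf_over (S_g U) (stratum_X U) X'"
    let ?C = "?N \<inter> (X' \<times> UNIV)"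
    \<comment> \<open>This relatively open part of the cone contains \<open>(?O, d)\<close> but
      nothing over points with nonzero first coordinate.\<close>
    let ?V = "?C \<inter> {q. snd q $ 2 \<noteq> 0}"
    have "open {q :: (real^3) \<times> (real^3). snd q $ 2 \<noteq> 0}"
      by (intro open_Collect_neq continuous_intros)
    then have "openin (top_of_set X') (fst ` ?V)"
      using npf unfolding npf_over_def open_map_def by (blast intro: openin_open_Int)
    \<comment> \<open>The image, open in the axis and containing the origin, must also contain
      points (1/(n+1), 0, 0), over which \<open>?V\<close> is empty.\<close>
    then have "openin (top_of_set (stratum_X U)) (fst ` ?V)"
      using X' openin_trans by blast
    then obtain T where T: "open T" "fst ` ?V = stratum_X U \<inter> T"
      by (auto simp: openin_open)
    have "?O \<in> fst ` ?V"
      using d_in d2 X' by force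
    then have "?O \<in> T"
      using T by blast
    have x: "(\<lambda>n. 1 / real (Suc n)) \<longlonglongrightarrow> 0"
      by real_asymp
    have "(\<lambda>n. vector [1 / real (Suc n), 0, 0] :: real^3) \<longlonglongrightarrow> ?O"
      by (intro tendsto_vector_3 x tendsto_const)
    then have "\<forall>\<^sub>F n in sequentially. vector [1 / real (Suc n), 0, 0] \<in> T"
      using T(1) \<open>?O \<in> T\<close> topological_tendstoD by blast
    moreover have "\<forall>\<^sub>F n in sequentially. (1 / real (Suc n), 0) \<in> U"
      by (intro in_U x tendsto_const)
    ultimately have "\<forall>\<^sub>F n in sequentially.
        vector [1 / real (Suc n), 0, 0] \<in> T \<and> (1 / real (Suc n), 0) \<in> U"
      by (rule eventually_conj)
    then obtain n where n: "vector [1 / real (Suc n), 0, 0] \<in> T" "(1 / real (Suc n), 0) \<in> U"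
      by (auto simp del: of_nat_Suc dest: eventually_happens)
    then have "vector [1 / real (Suc n), 0, 0] \<in> stratum_X U \<inter> T"
      by (auto simp: stratum_X_def simp del: of_nat_Suc)
    then have "vector [1 / real (Suc n), 0, 0] \<in> fst ` ?V"
      unfolding T(2) .
    then obtain v where "(vector [1 / real (Suc n), 0, 0], v) \<in> ?N" "v $ 2 \<noteq> 0"
      by auto
    then show False
      using normal_cone_direction[of "vector [1 / real (Suc n), 0, 0]" v U] by simp
  qed
qed

end
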